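(* For any integer $n\ge 2$, \[ \sum_{\substack{1\le k\le n\\ (n,k)=1}}\frac{1}{[k]}\equiv\frac{(1-q)\varphi(n)}{2}+\frac{(1-q)(1-q^n)J_2(n)}{24}\pmod{[n]\Phi_n(q)}, \] where $\varphi$ is Euler's totient function and $J_2(n)=\sum_{d\mid n}\mu(n/d)\,d^2$ is the Jordan totient function of order $2$ ($\mu$ the Möbius function).
   Context: $q$ is an indeterminate, $(n,k)=\gcd(n,k)$, and $[k]=(1-q^k)/(1-q)=1+q+\cdots+q^{k-1}$ denotes the $q$-integer. $\Phi_n(q)=\prod_{1\le k\le n,\,(n,k)=1}(q-\zeta^k)$ is the $n$th cyclotomic polynomial, $\zeta$ a primitive $n$th root of unity. Congruences of rational functions: for $A_1(q),A_2(q),P(q)\in\mathbb{Z}[q]$, $A_1(q)/A_2(q)\equiv 0\pmod{P(q)}$ means $P(q)$ divides $A_1(q)$ and $A_2(q)$ is coprime to $P(q)$; for rational functions $A(q),B(q)\in\mathbb{Z}(q)$, $A(q)\equiv B(q)\pmod{P(q)}$ means $A(q)-B(q)\equiv 0\pmod{P(q)}$. *)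

theory Defs
  imports
    "HOL-Computational_Algebra.Computational_Algebra"
    "HOL-Number_Theory.Totient"
begin

text \<open>
  The indeterminate \<open>q\<close> of \<open>\<int>[q]\<close> is \<^term>\<open>[:0, 1:] :: int poly\<close>, and \<open>\<int>(q)\<close> is the fraction
  field \<^typ>\<open>int poly fract\<close>, into which \<open>\<int>[q]\<close> is embedded by \<^const>\<open>to_fract\<close>.
\<close>

definition q_poly :: "int poly" where
  "q_poly = [:0, 1:]"

definition q_rat :: "int poly fract" where
  "q_rat = to_fract q_poly"

definition q_int :: "nat \<Rightarrow> int poly" where
  "q_int k = (\<Sum>i<k. q_poly ^ i)"

lemma q_int_closed_form: "(1 - q_poly) * q_int k = 1 - q_poly ^ k"
  unfolding q_int_def by (rule one_diff_power_eq [symmetric])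

lemma q_int_eq_quotient:
  "to_fract (q_int k) = (1 - q_rat ^ k) / (1 - q_rat)"
proof -
  have pw: "to_fract (q_poly ^ k) = q_rat ^ k"
    unfolding q_rat_def by (induction k) simp_all
  have "1 - q_poly \<noteq> 0"
    by (simp add: q_poly_def one_pCons)
  then have nz: "1 - q_rat \<noteq> 0"
    unfolding q_rat_def by (metis to_fract_1 to_fract_diff to_fract_eq_0_iff)
  have "(1 - q_rat) * to_fract (q_int k) = 1 - q_rat ^ k"
    using arg_cong [OF q_int_closed_form [of k], of to_fract] by (simp add: pw q_rat_def)
  with nz show ?thesis
    by (simp add: nonzero_eq_divide_eq mult.commute)
qed


text \<open>
  The relation \<open>A(q) \<equiv> 0 (mod P(q))\<close> asks for some way of writing \<open>A = A\<^sub>1 / A\<^sub>2\<close> such that \<open>P\<close>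
  divides \<open>A\<^sub>1\<close> in \<open>\<int>[q]\<close> and \<open>A\<^sub>2\<close> is coprime to \<open>P\<close>. Coprimality is that of the factorial ring
  \<open>\<int>[q]\<close> (only units \<open>\<plusminus>1\<close> as common divisors), not comaximality of ideals; in particular nonzero
  integers are coprime to a monic polynomial and are allowed as denominators.
\<close>

definition rat_cong_zero :: "int poly fract \<Rightarrow> int poly \<Rightarrow> bool" where
  "rat_cong_zero A P \<longleftrightarrow>
     (\<exists>A1 A2. A2 \<noteq> 0 \<and> A = to_fract A1 / to_fract A2 \<and> P dvd A1 \<and> coprime A2 P)"

definition rat_cong :: "int poly fract \<Rightarrow> int poly fract \<Rightarrow> int poly \<Rightarrow> bool" where
  "rat_cong A B P \<longleftrightarrow> rat_cong_zero (A - B) P"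


definition cyclotomic_complex :: "nat \<Rightarrow> complex poly" where
  "cyclotomic_complex n = (\<Prod>k | 1 \<le> k \<and> k \<le> n \<and> gcd n k = 1. [:- (cis (2 * pi / real n) ^ k), 1:])"

text \<open>
  The defining product lies in \<open>\<complex>[q]\<close>; \<open>cyclotomic n\<close> is the unique polynomial over \<open>\<int>\<close> with that
  image, whose existence is \<open>cyclotomic_ex1\<close> below.
\<close>

definition cyclotomic :: "nat \<Rightarrow> int poly" where
  "cyclotomic n = (THE p. map_poly of_int p = cyclotomic_complex n)"

definition int_coeffs :: "complex poly \<Rightarrow> bool" where
  "int_coeffs p \<longleftrightarrow> (\<forall>i. coeff p i \<in> \<int>)"

lemma int_coeffs_mult: "int_coeffs p \<Longrightarrow> int_coeffs r \<Longrightarrow> int_coeffs (p * r)"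
  unfolding int_coeffs_def by (auto simp: coeff_mult intro!: Ints_sum Ints_mult)

lemma int_coeffs_1: "int_coeffs 1"
  unfolding int_coeffs_def by (auto simp: coeff_1)

lemma int_coeffs_prod: "(\<And>x. x \<in> S \<Longrightarrow> int_coeffs (f x)) \<Longrightarrow> int_coeffs (prod f S)"
  by (induction S rule: infinite_finite_induct) (auto intro: int_coeffs_mult int_coeffs_1)

lemma int_coeffs_monic_quotient:
  assumes A: "int_coeffs A" "lead_coeff A = 1" and AQ: "int_coeffs (A * Q)"
  shows "int_coeffs Q"
proof -
  define d where "d = degree A"
  have "coeff Q j \<in> \<int>" for j
  proof (induction "degree Q + 1 - j" arbitrary: j rule: less_induct)
    case less
    show ?case
    proof (cases "j > degree Q")
      case True
      then show ?thesis by (simp add: coeff_eq_0)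
    next
      case False
      have "coeff (A * Q) (d + j) = (\<Sum>i\<le>d + j. coeff A i * coeff Q (d + j - i))"
        by (rule coeff_mult)
      also have "\<dots> = coeff A d * coeff Q (d + j - d) +
          (\<Sum>i\<in>{..d + j} - {d}. coeff A i * coeff Q (d + j - i))"
        by (rule sum.remove) auto
      finally have eq: "coeff Q j = coeff (A * Q) (d + j) -
          (\<Sum>i\<in>{..d + j} - {d}. coeff A i * coeff Q (d + j - i))"
        using A(2) by (simp add: d_def)
      have "coeff A i * coeff Q (d + j - i) \<in> \<int>" if "i \<in> {..d + j} - {d}" for i
      proof (cases "i < d")
        case True
        then have "coeff Q (d + j - i) \<in> \<int>"
          using False by (intro less) auto
        then show ?thesis using A(1) by (auto simp: int_coeffs_def intro: Ints_mult)
      next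
        case F: False
        then have "coeff A i = 0" using that by (intro coeff_eq_0) (auto simp: d_def)
        then show ?thesis by simp
      qed
      then show ?thesis
        unfolding eq using AQ by (intro Ints_diff Ints_sum) (auto simp: int_coeffs_def)
    qed
  qed
  then show ?thesis by (simp add: int_coeffs_def)
qed

lemma lead_coeff_cyclotomic_complex: "lead_coeff (cyclotomic_complex n) = 1"
  unfolding cyclotomic_complex_def by (simp add: lead_coeff_prod)

lemma prod_cyclotomic_complex:
  assumes n: "n > 0"
  shows "(\<Prod>d | d dvd n. cyclotomic_complex d) = monom 1 n - 1"
proof -
  define p :: "complex poly" where "p = monom 1 n - 1"
  define h :: "nat \<Rightarrow> complex poly" where "h k = [:- cis (2 * pi * real k / real n), 1:]" for k
  have pz: "poly p z = z ^ n - 1" for z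
    by (simp add: p_def poly_monom)
  have "degree (- 1 + monom (1 :: complex) n) = degree (monom (1 :: complex) n)"
    using n by (intro degree_add_eq_right) (simp add: degree_monom_eq)
  then have dp: "degree p = n"
    by (simp add: p_def degree_monom_eq)
  have lp: "lead_coeff p = 1"
    unfolding dp using n by (simp add: p_def coeff_1)
  have "rsquarefree p"
    unfolding rsquarefree_roots using n
    by (auto simp: pz p_def pderiv_monom pderiv_diff poly_monom power_0_left)
  from complex_poly_decompose_rsquarefree [OF this]
  have "p = (\<Prod>z | z ^ n = 1. [:- z, 1:])"
    by (simp add: lp pz)
  also have "\<dots> = (\<Prod>k<n. h k)"
    unfolding h_def by (rule prod.reindex_bij_betw [OF bij_betw_roots_unity [OF n], symmetric])
  also have "\<dots> = (\<Prod>k\<in>{1..n}. h k)"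
  proof -
    have "h n = h 0" using n by (simp add: h_def)
    moreover have "{..<n} = insert 0 {1..<n}" "{1..n} = insert n {1..<n}" using n by auto
    ultimately show ?thesis by simp
  qed
  also have "\<dots> = (\<Prod>d | d dvd n. \<Prod>k | k \<in> {1..n} \<and> n div gcd n k = d. h k)"
    using n by (intro prod.group [symmetric]) (auto simp: div_dvd_iff_mult)
  also have "\<dots> = (\<Prod>d | d dvd n. cyclotomic_complex d)"
  proof (intro prod.cong refl)
    fix d assume "d \<in> {d. d dvd n}"
    then obtain e where e: "n = d * e" by auto
    with n have pos: "d > 0" "e > 0" by auto
    have "(\<Prod>k | k \<in> {1..n} \<and> n div gcd n k = d. h k) =
        (\<Prod>k | 1 \<le> k \<and> k \<le> d \<and> gcd d k = 1. h (k * e))"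
    proof (rule prod.reindex_bij_witness [where i = "\<lambda>k. k * e" and j = "\<lambda>k. k div e"])
      fix k assume k: "k \<in> {k. k \<in> {1..n} \<and> n div gcd n k = d}"
      have "n = d * gcd n k" using k dvd_div_mult_self [of "gcd n k" n] by simp
      then have g: "gcd n k = e" using e pos by simp
      then have "e dvd k" by (metis gcd_dvd2 [of n k])
      then obtain m where m: "k = m * e" by (metis dvdE mult.commute)
      have "gcd d m * e = e" using g gcd_mult_distrib_nat [of e d m] by (simp add: e m mult.commute)
      then show "k div e * e = k" "k div e \<in> {k. 1 \<le> k \<and> k \<le> d \<and> gcd d k = 1}"
          "h (k div e * e) = h k"
        using pos k by (auto simp: m e)
    next
      fix k assume k: "k \<in> {k. 1 \<le> k \<and> k \<le> d \<and> gcd d k = 1}"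
      have "gcd n (k * e) = e" using k gcd_mult_distrib_nat [of e d k] by (simp add: e mult.commute)
      then show "k * e div e = k" "k * e \<in> {k. k \<in> {1..n} \<and> n div gcd n k = d}"
        using pos k by (auto simp: e)
    qed
    also have "\<dots> = cyclotomic_complex d"
      unfolding cyclotomic_complex_def h_def
      using pos by (intro prod.cong refl) (simp add: e Complex.DeMoivre field_simps)
    finally show "(\<Prod>k | k \<in> {1..n} \<and> n div gcd n k = d. h k) = cyclotomic_complex d" .
  qed
  finally show ?thesis by (simp add: p_def)
qed

lemma int_coeffs_cyclotomic_complex: "int_coeffs (cyclotomic_complex n)"
proof (induction n rule: less_induct)
  case (less n)
  show ?case
  proof (cases "n = 0")
    case True
    then have "{k. 1 \<le> k \<and> k \<le> n \<and> gcd n k = 1} = {}" by auto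
    then show ?thesis
      unfolding cyclotomic_complex_def by (simp only: prod.empty int_coeffs_1)
  next
    case False
    define A where "A = (\<Prod>d\<in>{d. d dvd n} - {n}. cyclotomic_complex d)"
    have "(\<Prod>d | d dvd n. cyclotomic_complex d) = cyclotomic_complex n * A"
      unfolding A_def using False by (intro prod.remove) auto
    then have "A * cyclotomic_complex n = monom 1 n - 1"
      using prod_cyclotomic_complex [of n] False by (simp add: mult.commute)
    moreover have "int_coeffs (monom 1 n - 1)"
      unfolding int_coeffs_def by (auto simp: coeff_1)
    moreover have "int_coeffs A"
      unfolding A_def using False by (intro int_coeffs_prod less) (auto dest: dvd_imp_le)
    moreover have "lead_coeff A = 1"
      unfolding A_def by (simp add: lead_coeff_prod lead_coeff_cyclotomic_complex)
    ultimately show ?thesis by (metis int_coeffs_monic_quotient)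
  qed
qed

lemma cyclotomic_ex1: "\<exists>!p :: int poly. map_poly of_int p = cyclotomic_complex n"
proof -
  let ?c = "cyclotomic_complex n"
  have *: "of_int \<lfloor>Re (coeff ?c i)\<rfloor> = coeff ?c i" for i
  proof -
    from int_coeffs_cyclotomic_complex [of n] obtain m where "coeff ?c i = of_int m"
      unfolding int_coeffs_def by (meson Ints_cases)
    then show ?thesis by simp
  qed
  have "map_poly of_int (map_poly (\<lambda>x. \<lfloor>Re x\<rfloor>) ?c) = ?c"
    by (rule poly_eqI) (simp add: coeff_map_poly *)
  moreover have "p = r"
    if "map_poly of_int p = ?c" "map_poly of_int r = ?c" for p r :: "int poly"
  proof (rule poly_eqI)
    fix i
    have "coeff (map_poly complex_of_int p) i = coeff (map_poly complex_of_int r) i"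
      using that by simp
    then show "coeff p i = coeff r i" by (simp add: coeff_map_poly)
  qed
  ultimately show ?thesis by blast
qed

lemma map_poly_cyclotomic: "map_poly of_int (cyclotomic n) = cyclotomic_complex n"
  unfolding cyclotomic_def by (rule theI' [OF cyclotomic_ex1])


definition moebius :: "nat \<Rightarrow> int" where
  "moebius n = (if squarefree n then (-1) ^ card (prime_factors n) else 0)"

definition jordan_totient2 :: "nat \<Rightarrow> int" where
  "jordan_totient2 n = (\<Sum>d | d dvd n. moebius (n div d) * int d ^ 2)"

end

theory Submission
  imports Defs
begin

text \<open>
  Pairing \<open>k\<close> with \<open>n - k\<close> and using \<open>[k] + [n - k] = (1 - q)[k][n - k] + [n]\<close>, twice the left-hand
  side is \<open>(1 - q) \<phi>(n) + [n] \<Sum>\<^sub>k 1 / ([k][n - k])\<close>. It remains to evaluate this last sum at the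
  primitive \<open>n\<close>th roots of unity \<open>\<zeta>\<close>, i.e. to show
  \<open>12 \<Sum>\<^sub>k 1 / ((1 - \<zeta>\<^sup>k)(1 - \<zeta>\<^sup>-\<^sup>k)) = J\<^sub>2(n)\<close>. Over all \<open>n\<close>th roots of unity \<open>\<noteq> 1\<close> the analogous sum
  is \<open>n\<^sup>2 - 1\<close>: since \<open>\<Sum>\<^sub>j\<^sub><\<^sub>n j \<zeta>\<^sup>j = -n / (1 - \<zeta>)\<close>, this is Parseval's identity for \<open>j \<mapsto> j\<close>.
  Moebius inversion then isolates the primitive roots. Divisibility descends from \<open>\<complex>[q]\<close> to \<open>\<int>[q]\<close>
  because \<open>[n] \<Phi>\<^sub>n\<close> is monic.
\<close>

section \<open>Moebius inversion over the divisors of \<open>n\<close>\<close>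

text \<open>Multiplication by a prime factor \<open>p\<close> of \<open>n\<close> pairs the squarefree divisors without \<open>p\<close> with those
  containing \<open>p\<close>, reversing the sign.\<close>
lemma sum_moebius_divisors:
  fixes n :: nat
  assumes "n > 1"
  shows "(\<Sum>d | d dvd n. moebius d) = 0"
proof -
  obtain p where p: "prime p" "p dvd n"
    using assms prime_factor_nat [of n] by auto
  define A where "A = {d. d dvd n \<and> squarefree d \<and> \<not> p dvd d}"
  define B where "B = {d. d dvd n \<and> squarefree d \<and> p dvd d}"
  have fin: "finite {d. d dvd n}" using assms by simp
  have finAB: "finite A" "finite B"
    unfolding A_def B_def by (rule finite_subset [OF _ fin]; auto)+
  have cop: "coprime p d" if "d \<in> A" for d
    using that p by (auto simp: A_def prime_imp_coprime_nat)
  have B_eq: "B = (*) p ` A"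
  proof safe
    fix d assume d: "d \<in> A"
    then show "p * d \<in> B"
      using cop [OF d] p
      by (auto simp: A_def B_def divides_mult squarefree_mult_coprime squarefree_prime)
  next
    fix d assume d: "d \<in> B"
    then obtain e where e: "d = p * e" by (auto simp: B_def)
    have "\<not> p dvd e"
    proof
      assume "p dvd e"
      then have "p\<^sup>2 dvd d" by (simp add: e power2_eq_square)
      with d p show False by (auto simp: B_def squarefree_def)
    qed
    moreover have "e dvd n" using d by (auto simp: B_def e intro: dvd_mult_right)
    moreover have "squarefree e" using d by (auto simp: B_def e dest: squarefree_multD)
    ultimately show "d \<in> (*) p ` A" by (auto simp: A_def e)
  qed
  have minus: "moebius (p * d) = - moebius d" if d: "d \<in> A" for d
  proof -
    have d0: "d \<noteq> 0" using d assms by (auto simp: A_def intro: Nat.gr0I)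
    have sq: "squarefree d" "squarefree (p * d)"
      using d p cop [OF d] by (auto simp: A_def squarefree_mult_coprime squarefree_prime)
    have "prime_factors (p * d) = insert p (prime_factors d)"
      using p d0 by (subst prime_factors_product) (auto simp: prime_prime_factors)
    moreover have "p \<notin> prime_factors d" using d by (auto simp: A_def)
    ultimately show ?thesis using sq by (simp add: moebius_def)
  qed
  have "(\<Sum>d | d dvd n. moebius d) = (\<Sum>d \<in> A \<union> B. moebius d)"
    using fin by (intro sum.mono_neutral_right) (auto simp: A_def B_def moebius_def)
  also have "\<dots> = (\<Sum>d\<in>A. moebius d) + (\<Sum>d\<in>B. moebius d)"
    using finAB by (intro sum.union_disjoint) (auto simp: A_def B_def)
  also have "(\<Sum>d\<in>B. moebius d) = (\<Sum>d\<in>A. moebius (p * d))"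
    unfolding B_eq using p by (subst sum.reindex) (auto simp: inj_on_def)
  also have "\<dots> = - (\<Sum>d\<in>A. moebius d)"
    by (simp add: minus sum_negf)
  finally show ?thesis by simp
qed

text \<open>Insert the divisor sum for \<open>f d\<close> and swap the summations: the coefficient
  of each \<open>F e\<close> is a Moebius sum over all divisors of \<open>n div e\<close>, which
  vanishes unless \<open>e = n\<close>.\<close>

lemma moebius_inversion:
  fixes F f :: "nat \<Rightarrow> 'a :: comm_ring_1"
  assumes f: "\<And>m. m > 0 \<Longrightarrow> f m = (\<Sum>d | d dvd m. F d)" and n: "n > 0"
  shows "(\<Sum>d | d dvd n. of_int (moebius (n div d)) * f d) = F n"
proof -
  have fin: "finite {d. d dvd m}" if "m > 0" for m :: nat using that by simp
  \<comment> \<open>The substitution \<open>b = n div d\<close> turns the divisors of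
    \<open>n\<close> that are multiples of \<open>e\<close> into the divisors of
    \<open>c = n div e\<close>.\<close>
  have mo: "(\<Sum>d | d dvd n \<and> e dvd d. moebius (n div d)) = (if e = n then 1 else 0)"
    if e: "e dvd n" for e
  proof -
    obtain c where c: "n = e * c" using e by auto
    have pos: "e > 0" "c > 0" using n c by auto
    have "(\<Sum>d | d dvd n \<and> e dvd d. moebius (n div d)) = (\<Sum>b | b dvd c. moebius b)"
      by (rule sum.reindex_bij_witness [where i = "\<lambda>b. n div b" and j = "\<lambda>d. n div d"])
        (use pos in \<open>auto simp: c elim!: dvdE\<close>)
    also have "\<dots> = (if e = n then 1 else 0)"
    proof (cases "c = 1")
      case True
      then show ?thesis by (simp add: c moebius_def)
    next
      case False
      then show ?thesis using pos sum_moebius_divisors [of c] by (simp add: c)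
    qed
    finally show ?thesis .
  qed
  have "(\<Sum>d | d dvd n. of_int (moebius (n div d)) * f d)
      = (\<Sum>d | d dvd n. \<Sum>e | e dvd n \<and> e dvd d. of_int (moebius (n div d)) * F e)"
  proof (intro sum.cong refl)
    fix d assume d: "d \<in> {d. d dvd n}"
    then have "{e. e dvd n \<and> e dvd d} = {e. e dvd d}" by (auto intro: dvd_trans)
    moreover have "d > 0" using d n by (auto intro: Nat.gr0I)
    ultimately show "of_int (moebius (n div d)) * f d
        = (\<Sum>e | e dvd n \<and> e dvd d. of_int (moebius (n div d)) * F e)"
      by (simp add: f sum_distrib_left)
  qed
  also have "\<dots> = (\<Sum>e | e dvd n. \<Sum>d | d dvd n \<and> e dvd d. of_int (moebius (n div d)) * F e)"
    using sum.swap_restrict [OF fin fin, OF n n,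
        of "\<lambda>d e. of_int (moebius (n div d)) * F e" "\<lambda>d e. e dvd d"] by simp
  also have "\<dots> = (\<Sum>e | e dvd n. of_int (\<Sum>d | d dvd n \<and> e dvd d. moebius (n div d)) * F e)"
    by (simp add: sum_distrib_right)
  also have "\<dots> = (\<Sum>e | e dvd n. if e = n then F e else 0)"
    by (intro sum.cong refl) (simp add: mo)
  also have "\<dots> = F n" using fin [OF n] by (simp add: sum.delta')
  finally show ?thesis .
qed

section \<open>Parseval's identity on the \<open>n\<close>th roots of unity\<close>

text \<open>At an \<open>n\<close>th root of unity \<open>z\<close> other than 1 the geometric sum
  vanishes and \<open>z ^ n = 1\<close>, which yields the closed form \<open>- n / (1 - z)\<close>
  for the weighted sum.\<close>

lemma one_minus_times_sum_power:
  fixes z :: "'a :: comm_ring_1"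
  shows "(1 - z) * (\<Sum>j<n. of_nat j * z ^ j) = z * (\<Sum>j<n. z ^ j) - of_nat n * z ^ n"
proof (induction n)
  case (Suc n)
  then show ?case
    by (simp only: sum.lessThan_Suc distrib_left) (simp add: algebra_simps)
qed simp

lemma sum_powers_root_unity:
  fixes z :: "'a :: idom"
  assumes "z ^ n = 1" "z \<noteq> 1"
  shows "(\<Sum>j<n. z ^ j) = 0"
  using one_diff_power_eq [of z n] assms by simp

text \<open>By \<open>e k ^ i = e i ^ k\<close> the sum is geometric with ratio
  \<open>c = e i / e j\<close>, an \<open>n\<close>th root of unity that equals 1 only for
  \<open>i = j\<close>, since \<open>e\<close> is injective below \<open>n\<close>.\<close>

lemma root_unity_orthogonality:
  fixes i j n :: nat
  assumes "i < n" "j < n"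
  shows "(\<Sum>z | z ^ n = (1 :: complex). z ^ i * inverse z ^ j) = (if i = j then of_nat n else 0)"
proof -
  have n: "n > 0" using assms by auto
  define e :: "nat \<Rightarrow> complex" where "e k = cis (2 * pi * real k / real n)" for k
  have bij: "bij_betw e {..<n} {z. z ^ n = 1}"
    unfolding e_def by (rule bij_betw_roots_unity [OF n])
  have e_mult: "e k ^ i = e i ^ k" for i k
    by (simp add: e_def Complex.DeMoivre mult_ac)
  have e_n: "e k ^ n = 1" for k
    using n by (simp add: e_def Complex.DeMoivre cis_multiple_2pi)
  have nz: "e k \<noteq> 0" for k by (simp add: e_def)
  define c where "c = e i * inverse (e j)"
  have "(\<Sum>z | z ^ n = 1. z ^ i * inverse z ^ j) = (\<Sum>k<n. e k ^ i * inverse (e k) ^ j)"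
    using sum.reindex_bij_betw [OF bij, of "\<lambda>z. z ^ i * inverse z ^ j"] by simp
  also have "\<dots> = (\<Sum>k<n. c ^ k)"
    by (intro sum.cong refl) (simp add: c_def power_mult_distrib power_inverse e_mult)
  also have "\<dots> = (if i = j then of_nat n else 0)"
  proof (cases "i = j")
    case True
    then show ?thesis by (simp add: c_def nz)
  next
    case False
    then have "e i \<noteq> e j" using bij assms by (auto simp: bij_betw_def inj_on_def)
    then have "c \<noteq> 1" using nz [of j] by (simp add: c_def field_simps)
    moreover have "c ^ n = 1" by (simp add: c_def power_mult_distrib power_inverse e_n)
    ultimately show ?thesis using False by (simp add: sum_powers_root_unity)
  qed
  finally show ?thesis .
qed

lemma sum_upto_of_nat:
  "2 * (\<Sum>j<n. of_nat j :: 'a :: comm_ring_1) = of_nat n * (of_nat n - 1)"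
  by (induction n) (simp_all add: algebra_simps)

lemma sum_upto_of_nat_squares:
  "6 * (\<Sum>j<n. of_nat j ^ 2 :: 'a :: comm_ring_1) = of_nat n * (of_nat n - 1) * (2 * of_nat n - 1)"
  by (induction n) (simp_all add: algebra_simps power2_eq_square)

text \<open>This is \<open>1 / |1 - z|\<^sup>2\<close> for \<open>|z| = 1\<close>; division by zero gives \<open>0\<close> at \<open>z = 1\<close>.\<close>
definition inv_dist2 :: "complex \<Rightarrow> complex" where
  "inv_dist2 z = 1 / ((1 - z) * (1 - inverse z))"

lemma inv_dist2_1 [simp]: "inv_dist2 1 = 0"
  by (simp add: inv_dist2_def)

text \<open>The sum of \<open>F z * F (inverse z)\<close> over \<open>U\<close> is computed twice:
  orthogonality gives \<open>n\<close> times the sum of squares, while the closed form of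
  \<open>F\<close> gives \<open>n^2 * inv_dist2 z\<close> at each \<open>z \<noteq> 1\<close>, and
  \<open>z = 1\<close> contributes \<open>F 1 * F 1\<close>.\<close>

lemma sum_inv_dist2_roots_unity:
  assumes n: "n > 0"
  shows "12 * (\<Sum>z | z ^ n = 1. inv_dist2 z) = of_nat n ^ 2 - 1"
proof -
  define U where "U = {z :: complex. z ^ n = 1}"
  define F where "F z = (\<Sum>j<n. of_nat j * z ^ j)" for z :: complex
  have fin: "finite U" unfolding U_def using n by (intro finite_roots_unity) simp
  have U1: "1 \<in> U" by (simp add: U_def)
  have F: "F z = - of_nat n / (1 - z)" if "z ^ n = 1" "z \<noteq> 1" for z
    using one_minus_times_sum_power [of z n] sum_powers_root_unity [OF that] that
    by (simp add: F_def field_simps)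
  have FF: "F z * F (inverse z) = of_nat n ^ 2 * inv_dist2 z" if "z \<in> U - {1}" for z
    using that F [of z] F [of "inverse z"]
    by (auto simp: U_def inv_dist2_def power_inverse power2_eq_square)
  have "(\<Sum>z\<in>U. F z * F (inverse z))
      = (\<Sum>z\<in>U. \<Sum>i<n. \<Sum>j<n. of_nat i * of_nat j * (z ^ i * inverse z ^ j))"
    by (simp add: F_def sum_product mult_ac)
  also have "\<dots> = (\<Sum>i<n. \<Sum>j<n. \<Sum>z\<in>U. of_nat i * of_nat j * (z ^ i * inverse z ^ j))"
    by (subst sum.swap, intro sum.cong refl, rule sum.swap)
  also have "\<dots> = (\<Sum>i<n. \<Sum>j<n. of_nat i * of_nat j * (\<Sum>z\<in>U. z ^ i * inverse z ^ j))"
    by (simp add: sum_distrib_left)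
  also have "\<dots> = (\<Sum>i<n. \<Sum>j<n. if i = j then of_nat i * of_nat j * of_nat n else 0)"
    unfolding U_def by (intro sum.cong refl) (simp add: root_unity_orthogonality)
  also have "\<dots> = of_nat n * (\<Sum>i<n. of_nat i ^ 2)"
    by (simp add: sum.delta power2_eq_square sum_distrib_left mult_ac)
  finally have parseval: "(\<Sum>z\<in>U. F z * F (inverse z)) = of_nat n * (\<Sum>i<n. of_nat i ^ 2)" .
  have "(\<Sum>z\<in>U. F z * F (inverse z))
      = F 1 * F 1 + (\<Sum>z\<in>U - {1}. of_nat n ^ 2 * inv_dist2 z)"
    using sum.remove [OF fin U1, of "\<lambda>z. F z * F (inverse z)"] FF by simp
  also have "(\<Sum>z\<in>U - {1}. of_nat n ^ 2 * inv_dist2 z) = of_nat n ^ 2 * (\<Sum>z\<in>U. inv_dist2 z)"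
    using sum.remove [OF fin U1, of inv_dist2] by (simp add: sum_distrib_left)
  finally have "of_nat n * (\<Sum>i<n. of_nat i ^ 2) = F 1 * F 1 + of_nat n ^ 2 * (\<Sum>z\<in>U. inv_dist2 z)"
    using parseval by simp
  moreover have "2 * F 1 = of_nat n * (of_nat n - 1)"
    using sum_upto_of_nat [of n, where 'a = complex] by (simp add: F_def)
  moreover note sum_upto_of_nat_squares [of n, where 'a = complex]
  moreover have "(of_nat n :: complex) \<noteq> 0" using n by simp
  \<comment> \<open>With \<open>X\<close> the sum of \<open>inv_dist2\<close>, 12 times Parseval
    reads \<open>2 n^2 (n - 1) (2 n - 1) = 3 n^2 (n - 1)^2 + 12 n^2 X\<close>; cancelling
    \<open>n^2\<close> leaves \<open>12 X = (n - 1) (n + 1)\<close>.\<close>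
  ultimately have "12 * (\<Sum>z\<in>U. inv_dist2 z) = of_nat n ^ 2 - 1"
    by algebra
  then show ?thesis by (simp add: U_def)
qed

section \<open>Isolating the primitive roots: the Jordan totient\<close>

text \<open>Indices \<open>k\<close> with \<open>gcd k n = d\<close> give the roots of exact order
  \<open>n div d\<close>, and \<open>k div d\<close> runs through the totatives of that
  order.\<close>

lemma sum_roots_unity_by_order:
  fixes f :: "complex \<Rightarrow> complex"
  assumes n: "n > 0"
  shows "(\<Sum>z | z ^ n = 1. f z)
    = (\<Sum>d | d dvd n. \<Sum>k\<in>totatives d. f (cis (2 * pi * real k / real d)))"
proof -
  define g where "g k = f (cis (2 * pi * real k / real n))" for k
  have "(\<Sum>z | z ^ n = 1. f z) = (\<Sum>k<n. g k)"
    unfolding g_def by (rule sum.reindex_bij_betw [OF bij_betw_roots_unity [OF n], symmetric])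
  \<comment> \<open>The root 1 is indexed by \<open>n\<close> instead of 0, because totatives are
    positive.\<close>
  also have "\<dots> = (\<Sum>k\<in>{0<..n}. g k)"
  proof -
    have "g n = g 0" using n by (simp add: g_def)
    moreover have "{..<n} = insert 0 {0<..<n}" "{0<..n} = insert n {0<..<n}" using n by auto
    ultimately show ?thesis by simp
  qed
  also have "\<dots> = (\<Sum>d | d dvd n. \<Sum>k | k \<in> {0<..n} \<and> gcd k n = d. g k)"
    using n by (intro sum.group [symmetric]) auto
  also have "\<dots> = (\<Sum>d | d dvd n. \<Sum>k\<in>totatives (n div d). g (k * d))"
    by (intro sum.cong refl sum.reindex_bij_betw [symmetric] bij_betw_totatives_gcd_eq n) simp
  also have "\<dots> = (\<Sum>d | d dvd n. \<Sum>k\<in>totatives d. f (cis (2 * pi * real k / real d)))"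
    by (rule sum.reindex_bij_witness [of _ "(div) n" "(div) n"])
      (use n in \<open>auto elim!: dvdE simp: g_def mult_ac intro!: sum.cong\<close>)
  finally show ?thesis .
qed

lemma jordan_totient2_eq_sum:
  assumes n: "n \<ge> 2"
  shows "of_int (jordan_totient2 n)
    = 12 * (\<Sum>k\<in>totatives n. inv_dist2 (cis (2 * pi * real k / real n)))"
proof -
  define G where "G d = (\<Sum>k\<in>totatives d. inv_dist2 (cis (2 * pi * real k / real d)))" for d
  \<comment> \<open>Twelve times the sum over all \<open>m\<close>th roots of unity is
    \<open>m^2 - 1\<close>; the extra 1 at \<open>d = 1\<close> restores \<open>m^2\<close>, whose
    Moebius inverse is the Jordan totient. At \<open>n \<ge> 2\<close> the correction
    disappears.\<close>
  define F where "F d = 12 * G d + (if d = 1 then 1 else 0)" for d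
  have "of_nat m ^ 2 = (\<Sum>d | d dvd m. F d)" if m: "m > 0" for m
  proof -
    have "(\<Sum>d | d dvd m. F d) = 12 * (\<Sum>d | d dvd m. G d) + 1"
      using m by (simp add: F_def sum.distrib sum_distrib_left sum.delta)
    also have "(\<Sum>d | d dvd m. G d) = (\<Sum>z | z ^ m = 1. inv_dist2 z)"
      unfolding G_def by (rule sum_roots_unity_by_order [OF m, symmetric])
    finally show ?thesis using sum_inv_dist2_roots_unity [OF m] by simp
  qed
  from moebius_inversion [of "\<lambda>m. of_nat m ^ 2" F, OF this, of n] n
  have "of_int (jordan_totient2 n) = F n"
    by (simp add: jordan_totient2_def)
  with n show ?thesis by (simp add: F_def G_def)
qed

section \<open>Independence of the chosen primitive root\<close>

text \<open>Coprimality lets \<open>m\<close> be cancelled modulo \<open>n\<close>, so the map is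
  injective; an injective self-map of a finite set is onto.\<close>

lemma bij_betw_totatives_mult_mod:
  assumes n: "n > 1" and m: "coprime m n"
  shows "bij_betw (\<lambda>k. m * k mod n) (totatives n) (totatives n)"
proof -
  have inj: "inj_on (\<lambda>k. m * k mod n) (totatives n)"
  proof (rule inj_onI)
    fix j k assume jk: "j \<in> totatives n" "k \<in> totatives n" "m * j mod n = m * k mod n"
    then have "[j = k] (mod n)"
      using cong_mult_lcancel_nat [of m n j k] m by (simp add: cong_def)
    then show "j = k"
      using jk n totatives_less [of j n] totatives_less [of k n] by (simp add: cong_def)
  qed
  have "m * k mod n \<in> totatives n" if k: "k \<in> totatives n" for k
  proof -
    have "coprime (m * k mod n) n"
      using k m n by (simp add: in_totatives_iff)
    moreover from this have "m * k mod n \<noteq> 0"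
      using n by (intro notI) simp
    ultimately show ?thesis
      using n mod_less_divisor [of n "m * k"] by (simp add: in_totatives_iff)
  qed
  then have "(\<lambda>k. m * k mod n) ` totatives n \<subseteq> totatives n" by auto
  with inj show ?thesis
    by (simp add: bij_betw_def endo_inj_surj)
qed

text \<open>Raising to the power \<open>m\<close> only permutes the primitive roots. Hence the sum
  has the same value at every root of the cyclotomic polynomial, and one computation settles them
  all.\<close>

lemma sum_powers_primitive_root:
  fixes f :: "complex \<Rightarrow> complex"
  assumes n: "n > 1" and m: "coprime m n"
  defines "w \<equiv> cis (2 * pi / real n)"
  shows "(\<Sum>k\<in>totatives n. f ((w ^ m) ^ k)) = (\<Sum>k\<in>totatives n. f (cis (2 * pi * real k / real n)))"
proof -
  have w_n: "w ^ n = 1" using n by (simp add: w_def Complex.DeMoivre)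
  have w_mod: "w ^ (k mod n) = w ^ k" for k
  proof -
    have "w ^ k = w ^ (n * (k div n) + k mod n)" by simp
    also have "\<dots> = w ^ (k mod n)" by (simp only: power_add power_mult w_n) simp
    finally show ?thesis ..
  qed
  have "(\<Sum>k\<in>totatives n. f ((w ^ m) ^ k)) = (\<Sum>k\<in>totatives n. f (w ^ (m * k mod n)))"
    by (simp add: w_mod power_mult)
  also have "\<dots> = (\<Sum>k\<in>totatives n. f (w ^ k))"
    by (rule sum.reindex_bij_betw [OF bij_betw_totatives_mult_mod [OF n m]])
  also have "\<dots> = (\<Sum>k\<in>totatives n. f (cis (2 * pi * real k / real n)))"
    by (simp add: w_def Complex.DeMoivre mult_ac)
  finally show ?thesis .
qed

section \<open>Transfer between integer and complex polynomials\<close>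

abbreviation cpoly :: "int poly \<Rightarrow> complex poly" where
  "cpoly \<equiv> map_poly of_int"

lemma cpoly_add: "cpoly (p + r) = cpoly p + cpoly r"
  by (rule poly_eqI) (simp add: coeff_map_poly)

lemma cpoly_diff: "cpoly (p - r) = cpoly p - cpoly r"
  by (rule poly_eqI) (simp add: coeff_map_poly)

lemma cpoly_mult: "cpoly (p * r) = cpoly p * cpoly r"
  by (rule poly_eqI) (simp add: coeff_map_poly coeff_mult)

lemma cpoly_of_int: "cpoly (of_int c) = of_int c"
  by (simp add: of_int_poly map_poly_pCons)

lemma cpoly_1: "cpoly 1 = 1"
  using cpoly_of_int [of 1] by simp

lemma cpoly_numeral: "cpoly (numeral k) = numeral k"
  using cpoly_of_int [of "numeral k"] by simp

lemma cpoly_power: "cpoly (p ^ k) = cpoly p ^ k"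
  by (induction k) (simp_all add: cpoly_1 cpoly_mult)

lemma cpoly_sum: "cpoly (sum f A) = (\<Sum>x\<in>A. cpoly (f x))"
  by (induction A rule: infinite_finite_induct) (simp_all add: cpoly_add)

lemma cpoly_prod: "cpoly (prod f A) = (\<Prod>x\<in>A. cpoly (f x))"
  by (induction A rule: infinite_finite_induct) (simp_all add: cpoly_mult cpoly_1)

lemma cpoly_inject: "cpoly p = cpoly r \<longleftrightarrow> p = r"
  by (auto simp: poly_eq_iff coeff_map_poly)

lemma degree_cpoly: "degree (cpoly p) = degree p"
  by (rule degree_map_poly) simp

lemma lead_coeff_cpoly: "lead_coeff (cpoly p) = of_int (lead_coeff p)"
  by (simp add: degree_cpoly coeff_map_poly)

lemmas cpoly_simps =
  cpoly_add cpoly_diff cpoly_mult cpoly_of_int cpoly_1 cpoly_numeral cpoly_power cpoly_sum cpoly_prod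

text \<open>A complex quotient of integer polynomials by a monic one has integer coefficients, so it
  is the image of some \<open>R\<close>; injectivity of \<open>cpoly\<close> then brings the
  factorization back.\<close>

lemma monic_dvd_from_cpoly:
  assumes "lead_coeff P = 1" "cpoly P dvd cpoly M"
  shows "P dvd M"
proof -
  obtain Q where Q: "cpoly M = cpoly P * Q" using assms(2) by (rule dvdE)
  have ic: "int_coeffs (cpoly p)" for p
    by (simp add: int_coeffs_def coeff_map_poly)
  have "int_coeffs Q"
    by (rule int_coeffs_monic_quotient [OF ic [of P]])
      (use assms(1) ic [of M] in \<open>simp_all only: lead_coeff_cpoly Q of_int_1\<close>)
  then obtain R where "Q = cpoly R"
    unfolding int_coeffs_def by (metis intpolyE)
  then have "M = P * R" using Q by (simp flip: cpoly_mult add: cpoly_inject)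
  then show ?thesis by simp
qed

text \<open>Monicity of \<open>P\<close> excludes nonunit constant common factors, so common complex roots decide.\<close>
lemma coprime_monic_of_no_common_root:
  assumes P: "lead_coeff P = 1"
    and roots: "\<And>z. poly (cpoly P) z = 0 \<Longrightarrow> poly (cpoly D) z \<noteq> 0"
  shows "coprime D P"
proof (rule coprimeI)
  fix c assume c: "c dvd D" "c dvd P"
  obtain b where b: "P = c * b" using c(2) by (rule dvdE)
  show "is_unit c"
  proof (cases "degree c = 0")
    case True
    then obtain a where a: "c = [:a:]" by (rule degree_eq_zeroE)
    have "lead_coeff c * lead_coeff b = 1" using P by (simp only: b lead_coeff_mult)
    then have "lead_coeff c dvd 1" by (metis dvd_triv_left)
    then have "a dvd 1" by (simp add: a)
    then show ?thesis by (simp add: a is_unit_const_poly_iff)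
  next
    case False
    then have "\<not> constant (poly (cpoly c))"
      by (simp add: constant_degree degree_cpoly)
    then obtain z where "poly (cpoly c) z = 0"
      using fundamental_theorem_of_algebra by blast
    then have "poly (cpoly P) z = 0" "poly (cpoly D) z = 0"
      using c by (auto elim!: dvdE simp: cpoly_mult)
    with roots show ?thesis by blast
  qed
qed

text \<open>Roots are split off one at a time: injectivity of \<open>r\<close> keeps
  \<open>r a\<close> from being a root of the factors already removed, so it is a root of the
  cofactor \<open>N\<close>.\<close>

lemma prod_linear_factors_dvd:
  fixes M :: "'a :: field poly"
  assumes "finite A" "inj_on r A" "\<And>k. k \<in> A \<Longrightarrow> poly M (r k) = 0"
  shows "(\<Prod>k\<in>A. [:- r k, 1:]) dvd M"
  using assms
proof (induction A rule: finite_induct)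
  case (insert a A)
  then have "(\<Prod>k\<in>A. [:- r k, 1:]) dvd M" by auto
  then obtain N where N: "M = (\<Prod>k\<in>A. [:- r k, 1:]) * N" by (rule dvdE)
  have "poly (\<Prod>k\<in>A. [:- r k, 1:]) (r a) \<noteq> 0"
    using insert by (auto simp: poly_prod inj_on_def)
  moreover have "poly M (r a) = 0" using insert by simp
  ultimately have "poly N (r a) = 0" by (simp add: N)
  then have "[:- r a, 1:] dvd N" by (simp add: poly_eq_0_iff_dvd)
  then have "[:- r a, 1:] * (\<Prod>k\<in>A. [:- r k, 1:]) dvd N * (\<Prod>k\<in>A. [:- r k, 1:])"
    by (rule mult_dvd_mono) simp
  then show ?case
    using insert.hyps by (simp only: prod.insert N mult.commute [of _ N] not_False_eq_True)
qed simp

section \<open>q-integers and the roots of the cyclotomic polynomial\<close>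

lemma q_int_add: "q_int (a + b) = q_int a + q_poly ^ a * q_int b"
  by (induction b) (simp_all add: q_int_def power_add algebra_simps)

text \<open>Replace \<open>q^k\<close> by \<open>1 - (1 - q) [k]\<close> in
  \<open>[n] = [k] + q^k [n - k]\<close>. After division by \<open>[k] [n - k]\<close>, the constant
  term \<open>1 - q\<close> is what produces the totient.\<close>

lemma q_int_add_q_int_diff:
  assumes "k \<le> n"
  shows "q_int k + q_int (n - k) = (1 - q_poly) * (q_int k * q_int (n - k)) + q_int n"
proof -
  have "q_int n = q_int k + q_poly ^ k * q_int (n - k)"
    using q_int_add [of k "n - k"] assms by simp
  moreover have "(1 - q_poly) * (q_int k * q_int (n - k)) = (1 - q_poly ^ k) * q_int (n - k)"
    by (simp flip: q_int_closed_form add: mult.assoc)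
  ultimately show ?thesis by (simp add: algebra_simps)
qed

lemma coeff_q_int: "coeff (q_int n) i = (if i < n then 1 else 0)"
proof -
  have "q_poly ^ i = monom 1 i" for i
    by (simp add: q_poly_def monom_altdef)
  then have "coeff (q_int n) i = (\<Sum>j<n. if j = i then 1 else 0)"
    by (simp add: q_int_def coeff_sum)
  then show ?thesis by simp
qed

lemma lead_coeff_q_int:
  assumes "n > 0"
  shows "lead_coeff (q_int n) = 1"
proof -
  have "degree (q_int n) = n - 1"
    using assms by (intro antisym degree_le le_degree) (auto simp: coeff_q_int)
  with assms show ?thesis by (simp add: coeff_q_int)
qed

lemma q_int_nonzero: "n > 0 \<Longrightarrow> q_int n \<noteq> 0"
  using lead_coeff_q_int [of n] by auto

lemma lead_coeff_cyclotomic: "lead_coeff (cyclotomic n) = 1"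
  using lead_coeff_cpoly [of "cyclotomic n"] lead_coeff_cyclotomic_complex [of n]
  by (simp add: map_poly_cyclotomic)

lemma poly_cpoly_q_poly: "poly (cpoly q_poly) z = z"
  by (simp add: q_poly_def map_poly_pCons)

lemma poly_cpoly_q_int: "poly (cpoly (q_int n)) z = (\<Sum>i<n. z ^ i)"
  by (simp add: q_int_def cpoly_simps poly_sum poly_cpoly_q_poly)

lemma one_minus_times_poly_cpoly_q_int: "(1 - z) * poly (cpoly (q_int n)) z = 1 - z ^ n"
  unfolding poly_cpoly_q_int by (rule one_diff_power_eq [symmetric])

text \<open>Bezout's \<open>a x = b y + 1\<close> turns \<open>z ^ (a x) = 1\<close> into
  \<open>z = 1\<close>. In the separate case \<open>a = 0\<close>, coprimality forces
  \<open>b = 1\<close>.\<close>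

lemma power_eq_1_coprime:
  fixes z :: complex
  assumes "z ^ a = 1" "z ^ b = 1" "coprime a b"
  shows "z = 1"
proof (cases "a = 0")
  case True
  with assms show ?thesis by simp
next
  case False
  then obtain x y where "a * x = b * y + gcd a b" using bezout_nat by blast
  then have "z ^ (a * x) = z ^ (b * y) * z" using assms(3) by simp
  then show ?thesis using assms by (simp add: power_mult)
qed

text \<open>If \<open>w ^ m\<close> were 1, coprimality of \<open>m\<close> and \<open>n\<close>
  would force \<open>w = 1\<close>, against the injectivity of the enumeration of the roots of
  unity.\<close>

lemma primitive_root_properties:
  assumes n: "n \<ge> 2" and m: "coprime m n"
  defines "z \<equiv> cis (2 * pi / real n) ^ m"
  shows "z ^ n = 1" "z \<noteq> 1"
proof -
  have inj: "inj_on (\<lambda>k. cis (2 * pi * real k / real n)) {..<n}"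
    using bij_betw_roots_unity [of n] n by (simp add: bij_betw_def)
  define w where "w = cis (2 * pi / real n)"
  have w: "w ^ n = 1" "w \<noteq> 1"
    using inj_onD [OF inj, of 1 0] n by (auto simp: w_def Complex.DeMoivre)
  show "z ^ n = 1"
    using w(1) unfolding z_def w_def [symmetric] by (metis power_mult mult.commute power_one)
  show "z \<noteq> 1"
    using w power_eq_1_coprime [of w m n] m unfolding z_def w_def [symmetric] by auto
qed

lemma cyclotomic_complex_eq:
  "cyclotomic_complex n = (\<Prod>k\<in>totatives n. [:- (cis (2 * pi / real n) ^ k), 1:])"
  unfolding cyclotomic_complex_def
  by (intro prod.cong) (auto simp: totatives_def coprime_iff_gcd_eq_1 gcd.commute)

text \<open>The primitive roots are distinct, so vanishing at all of them gives divisibility over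
  \<complex>, which descends because the cyclotomic polynomial is monic.\<close>

lemma cyclotomic_dvd:
  assumes n: "n \<ge> 2"
    and M: "\<And>m. m \<in> totatives n \<Longrightarrow> poly (cpoly M) (cis (2 * pi / real n) ^ m) = 0"
  shows "cyclotomic n dvd M"
proof (rule monic_dvd_from_cpoly [OF lead_coeff_cyclotomic])
  have pow: "cis (2 * pi / real n) ^ k = cis (2 * pi * real k / real n)" for k
    by (simp add: Complex.DeMoivre mult_ac)
  have "inj_on (\<lambda>k. cis (2 * pi / real n) ^ k) {..<n}"
    unfolding pow using bij_betw_roots_unity [of n] n by (simp add: bij_betw_def)
  then have "inj_on (\<lambda>k. cis (2 * pi / real n) ^ k) (totatives n)"
    by (rule inj_on_subset) (use n totatives_less [of _ n] in auto)
  then show "cpoly (cyclotomic n) dvd cpoly M"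
    unfolding map_poly_cyclotomic cyclotomic_complex_eq
    by (rule prod_linear_factors_dvd [OF finite_totatives _ M])
qed

text \<open>This makes \<open>k \<mapsto> n - k\<close> an involution of the totatives. For
  \<open>n = 1\<close> it would send the totative 1 to 0.\<close>

lemma totatives_diff:
  assumes "n \<ge> 2" "k \<in> totatives n"
  shows "n - k \<in> totatives n"
proof -
  have "k < n" using totatives_less [of k n] assms by simp
  then have "coprime (n - k) n \<longleftrightarrow> coprime k n"
    by (metis coprime_commute coprime_iff_gcd_eq_1 gcd_diff2_nat less_imp_le)
  with assms \<open>k < n\<close> show ?thesis by (simp add: in_totatives_iff)
qed

section \<open>Common denominators and the embedding into the fraction field\<close>

text \<open>Stated over an arbitrary field because it serves twice: in the fraction field to obtain
  \<open>T / E\<close>, and in \<complex> to evaluate that quotient at a root of unity.\<close>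

lemma sum_inverse_eq_divide_prod:
  fixes f :: "'a \<Rightarrow> 'b :: field"
  assumes "finite A" "\<And>k. k \<in> A \<Longrightarrow> f k \<noteq> 0"
  shows "(\<Sum>k\<in>A. 1 / f k) = (\<Sum>k\<in>A. prod f (A - {k})) / prod f A"
proof -
  have "1 / f k = prod f (A - {k}) / prod f A" if "k \<in> A" for k
    using assms that by (simp add: prod.remove [OF assms(1) that])
  then show ?thesis by (simp add: sum_divide_distrib)
qed

lemma to_fract_sum: "to_fract (sum f A) = (\<Sum>x\<in>A. to_fract (f x))"
  by (induction A rule: infinite_finite_induct) simp_all

lemma to_fract_prod: "to_fract (prod f A) = (\<Prod>x\<in>A. to_fract (f x))"
  by (induction A rule: infinite_finite_induct) simp_all

lemma to_fract_power: "to_fract (x ^ k) = to_fract x ^ k"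
  by (induction k) simp_all

lemma to_fract_of_nat: "to_fract (of_nat k) = of_nat k"
  by (induction k) simp_all

lemma to_fract_of_int: "to_fract (of_int c) = of_int c"
  by (cases c rule: int_cases2) (simp_all add: to_fract_of_nat)

lemma to_fract_numeral: "to_fract (numeral k) = numeral k"
  using to_fract_of_nat [of "numeral k"] by simp

section \<open>The congruence: reduction to one divisibility, its check at primitive roots, and
  coprimality of the denominator\<close>

theorem theorem1p2:
  fixes n :: nat
  assumes "n \<ge> 2"
  shows "rat_cong
    (\<Sum>k | 1 \<le> k \<and> k \<le> n \<and> gcd n k = 1. 1 / to_fract (q_int k))
    ((1 - q_rat) * of_nat (totient n) / 2
      + (1 - q_rat) * (1 - q_rat ^ n) * of_int (jordan_totient2 n) / 24)
    (q_int n * cyclotomic n)"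
proof -
  define C where "C = totatives n"
  define d where "d k = q_int k * q_int (n - k)" for k
  define E where "E = prod d C"
  define T where "T = (\<Sum>k\<in>C. prod d (C - {k}))"
  define J where "J = jordan_totient2 n"
  \<comment> \<open>The difference of the two sides will be \<open>q_int n * M / (24 * E)\<close>.
    The factor \<open>q_int n\<close> being explicit, it remains to show that the cyclotomic
    polynomial divides \<open>M\<close>.\<close>
  define M where "M = 12 * T - of_int J * ((1 - q_poly) ^ 2 * E)"
  define S where "S = (\<Sum>k\<in>C. 1 / to_fract (q_int k))"
  have finC: "finite C" by (simp add: C_def)
  have lt: "0 < k" "k < n" if "k \<in> C" for k
    using that assms totatives_less [of k n] by (auto simp: C_def in_totatives_iff)
  have C_eq: "{k. 1 \<le> k \<and> k \<le> n \<and> gcd n k = 1} = C"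
    by (auto simp: C_def totatives_def coprime_iff_gcd_eq_1 gcd.commute)
  have d_nz: "d k \<noteq> 0" if "k \<in> C" for k
    using lt [OF that] by (simp add: d_def q_int_nonzero)
  have E_nz: "E \<noteq> 0" using finC d_nz by (simp add: E_def)

  have S_sym: "S = (\<Sum>k\<in>C. 1 / to_fract (q_int (n - k)))"
    unfolding S_def
    by (rule sum.reindex_bij_witness [of _ "\<lambda>k. n - k" "\<lambda>k. n - k"])
      (use assms lt totatives_diff in \<open>auto simp: C_def less_imp_le\<close>)
  have pair: "1 / to_fract (q_int k) + 1 / to_fract (q_int (n - k))
      = (1 - q_rat) + to_fract (q_int n) * (1 / to_fract (d k))" if "k \<in> C" for k
  proof -
    have nz: "to_fract (q_int k) \<noteq> 0" "to_fract (q_int (n - k)) \<noteq> 0"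
      using lt [OF that] by (simp_all add: q_int_nonzero)
    have "to_fract (q_int k) + to_fract (q_int (n - k))
        = (1 - q_rat) * (to_fract (q_int k) * to_fract (q_int (n - k))) + to_fract (q_int n)"
      using arg_cong [OF q_int_add_q_int_diff [of k n], of to_fract] lt [OF that]
      by (simp add: q_rat_def)
    with nz show ?thesis by (simp add: d_def field_simps)
  qed
  have to_fract_T: "(\<Sum>k\<in>C. 1 / to_fract (d k)) = to_fract T / to_fract E"
    unfolding T_def E_def to_fract_sum to_fract_prod
    by (rule sum_inverse_eq_divide_prod [OF finC]) (simp add: d_nz)

  have "2 * S = (\<Sum>k\<in>C. 1 / to_fract (q_int k) + 1 / to_fract (q_int (n - k)))"
    using S_sym by (simp add: S_def sum.distrib)
  also have "\<dots> = (\<Sum>k\<in>C. (1 - q_rat) + to_fract (q_int n) * (1 / to_fract (d k)))"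
    by (intro sum.cong refl pair)
  also have "\<dots> = of_nat (totient n) * (1 - q_rat)
      + to_fract (q_int n) * (\<Sum>k\<in>C. 1 / to_fract (d k))"
    by (simp only: sum.distrib sum_distrib_left sum_constant) (simp add: C_def totient_def)
  finally have two_S: "2 * S = of_nat (totient n) * (1 - q_rat)
      + to_fract (q_int n) * (to_fract T / to_fract E)"
    unfolding to_fract_T .
  have q_n: "1 - q_rat ^ n = (1 - q_rat) * to_fract (q_int n)"
    using arg_cong [OF q_int_closed_form [of n], of to_fract]
    by (simp add: q_rat_def to_fract_power)
  have E_fract: "to_fract E \<noteq> 0" using E_nz by simp
  \<comment> \<open>Keeping \<open>2 * x\<close> together allows the formula for
    \<open>2 * S\<close> to be substituted afterwards.\<close>
  have clear: "24 * (x - (a / 2 + b / 24)) * e = 12 * (2 * x) * e - (12 * a + b) * e"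
    for x a b e :: "int poly fract"
  proof -
    have "24 * (x - (a / 2 + b / 24)) = 12 * (2 * x) - (12 * a + b)"
      by (simp add: field_simps)
    then show ?thesis by (simp only: left_diff_distrib)
  qed
  have "24 * (S - ((1 - q_rat) * of_nat (totient n) / 2
      + (1 - q_rat) * (1 - q_rat ^ n) * of_int J / 24)) * to_fract E
      = 12 * (2 * S) * to_fract E - (12 * ((1 - q_rat) * of_nat (totient n))
        + (1 - q_rat) * ((1 - q_rat) * to_fract (q_int n)) * of_int J) * to_fract E"
    unfolding q_n by (rule clear)
  also have "\<dots> = to_fract (q_int n * M)"
    using E_fract unfolding two_S
    by (simp add: M_def q_rat_def to_fract_of_int to_fract_numeral to_fract_power
        algebra_simps power2_eq_square)
  finally have diff_eq: "S - ((1 - q_rat) * of_nat (totient n) / 2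
      + (1 - q_rat) * (1 - q_rat ^ n) * of_int J / 24)
      = to_fract (q_int n * M) / to_fract (24 * E)"
    using E_fract by (simp add: field_simps to_fract_numeral)

  have "poly (cpoly M) (cis (2 * pi / real n) ^ m) = 0" if m: "m \<in> totatives n" for m
  proof -
    define z where "z = cis (2 * pi / real n) ^ m"
    have cop: "coprime m n" using m by (simp add: in_totatives_iff)
    have z: "z ^ n = 1" "z \<noteq> 1"
      using primitive_root_properties [OF assms cop] by (simp_all add: z_def)
    define h where "h p = poly (cpoly p) z" for p
    \<comment> \<open>Multiplication by \<open>(1 - z)^2\<close> turns the two q-integers into
      \<open>1 - z^k\<close> and \<open>1 - z^(n - k)\<close>, and \<open>z^(n - k)\<close> is the
      inverse of \<open>z^k\<close>.\<close>
    have d_inv: "1 / h (d k) = (1 - z) ^ 2 * inv_dist2 (z ^ k)" and h_d: "h (d k) \<noteq> 0"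
      if k: "k \<in> C" for k
    proof -
      have "z ^ k \<noteq> 1"
        using power_eq_1_coprime [of z k n] z k by (auto simp: C_def in_totatives_iff)
      have "z ^ k * z ^ (n - k) = 1"
        using lt [OF k] z by (simp flip: power_add)
      then have "z ^ (n - k) = inverse (z ^ k)" by (metis inverse_unique)
      then have "(1 - z) ^ 2 * h (d k) = (1 - z ^ k) * (1 - inverse (z ^ k))"
        using one_minus_times_poly_cpoly_q_int [of z k]
          one_minus_times_poly_cpoly_q_int [of z "n - k"]
        unfolding h_def d_def cpoly_mult poly_mult by (simp add: power2_eq_square mult_ac)
      moreover have "(1 - z ^ k) * (1 - inverse (z ^ k)) \<noteq> 0"
        using \<open>z ^ k \<noteq> 1\<close> by (simp add: inverse_eq_1_iff)
      ultimately show "1 / h (d k) = (1 - z) ^ 2 * inv_dist2 (z ^ k)" "h (d k) \<noteq> 0"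
        unfolding inv_dist2_def by (auto simp: divide_simps)
    qed
    have "h T / h E = (\<Sum>k\<in>C. 1 / h (d k))"
      unfolding h_def T_def E_def cpoly_sum cpoly_prod poly_sum poly_prod
      by (rule sum_inverse_eq_divide_prod [OF finC, symmetric]) (use h_d in \<open>simp add: h_def\<close>)
    also have "\<dots> = (1 - z) ^ 2 * (\<Sum>k\<in>totatives n. inv_dist2 (z ^ k))"
      by (simp add: d_inv C_def [symmetric] sum_distrib_left)
    also have "(\<Sum>k\<in>totatives n. inv_dist2 (z ^ k)) = of_int J / 12"
      using sum_powers_primitive_root [of n m inv_dist2] jordan_totient2_eq_sum [of n] assms cop
      by (simp add: J_def z_def)
    finally have "h T / h E = (1 - z) ^ 2 * (of_int J / 12)" .
    moreover have "h E \<noteq> 0"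
      using h_d finC by (simp add: h_def E_def cpoly_prod poly_prod)
    ultimately have "12 * h T = of_int J * ((1 - z) ^ 2 * h E)"
      by (simp add: field_simps)
    then show ?thesis
      by (simp add: M_def cpoly_simps poly_cpoly_q_poly h_def z_def)
  qed
  then have M_dvd: "cyclotomic n dvd M" by (rule cyclotomic_dvd [OF assms])

  \<comment> \<open>Every root of the modulus is an \<open>n\<close>th root of unity other than 1,
    while a root of \<open>q_int k\<close> is a \<open>k\<close>th root of unity; for
    \<open>k\<close> coprime to \<open>n\<close> both together would force the root to be 1.\<close>
  have E_root: "poly (cpoly (24 * E)) z \<noteq> 0" if "poly (cpoly (q_int n * cyclotomic n)) z = 0" for z
  proof -
    have z: "z ^ n = 1 \<and> z \<noteq> 1"
    proof (cases "poly (cpoly (q_int n)) z = 0")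
      case True
      then have "z ^ n = 1" using one_minus_times_poly_cpoly_q_int [of z n] by simp
      \<comment> \<open>At 1 the q-integer takes the nonzero value \<open>n\<close>.\<close>
      moreover have "z \<noteq> 1" using True assms by (auto simp: poly_cpoly_q_int)
      ultimately show ?thesis by simp
    next
      case False
      with that have "poly (cyclotomic_complex n) z = 0"
        by (simp add: cpoly_mult map_poly_cyclotomic)
      then obtain m where "m \<in> totatives n" "z = cis (2 * pi / real n) ^ m"
        by (auto simp: cyclotomic_complex_eq poly_prod)
      then show ?thesis
        using primitive_root_properties [OF assms, of m] by (simp add: in_totatives_iff)
    qed
    have nz: "poly (cpoly (q_int k)) z \<noteq> 0" if "k \<in> C" for k
    proof
      assume "poly (cpoly (q_int k)) z = 0"
      then have "z ^ k = 1" using one_minus_times_poly_cpoly_q_int [of z k] by simp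
      with z that power_eq_1_coprime [of z k n] show False
        by (auto simp: C_def in_totatives_iff)
    qed
    have "n - k \<in> C" if "k \<in> C" for k
      using that totatives_diff assms by (simp add: C_def)
    with nz finC show ?thesis
      by (simp add: E_def d_def cpoly_mult cpoly_prod cpoly_numeral poly_prod)
  qed
  have "lead_coeff (q_int n * cyclotomic n) = 1"
    using assms by (simp add: lead_coeff_mult lead_coeff_q_int lead_coeff_cyclotomic)
  then have "coprime (24 * E) (q_int n * cyclotomic n)"
    using E_root by (rule coprime_monic_of_no_common_root)
  moreover have "q_int n * cyclotomic n dvd q_int n * M"
    using M_dvd by simp
  moreover have "24 * E \<noteq> 0" using E_nz by simp
  ultimately show ?thesis
    unfolding rat_cong_def rat_cong_zero_def C_eq
    using diff_eq unfolding S_def J_def by blast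
qed

end
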